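(* Let $H^\infty$ be an infinite hallway which admits a line of sight. Then $H^\infty$ is periodic if and only if it admits a rational line of sight, i.e. a line of sight $\ell^\epsilon_{\alpha\beta}$ with $\alpha\in\mathbb{Q}$.
   Context: Let $\mathbb{R}^\epsilon=\{a+b\epsilon:a,b\in\mathbb{R}\}$ be the two-dimensional real vector space with basis $\{1,\epsilon\}$, totally ordered by $a+b\epsilon<c+d\epsilon$ iff $a<c$, or $a=c$ and $b<d$; intervals in $\mathbb{R}^\epsilon$ are taken with respect to this order. An infinite hallway is a set $H^\infty=\bigcup_{i\ge 0}\{i\}\times(\mathbb{R}^\epsilon\setminus D_i)\subset\mathbb{R}\times\mathbb{R}^\epsilon$, where $D_i=(d_i,d_i+1)\subset\mathbb{R}^\epsilon$ with $d_i\in\mathbb{Z}$ for all integers $i\ge 0$ (the $i$th doorway). For $\alpha,\beta\in\mathbb{R}$ the infinite line of slope $\alpha$ is $\ell^\epsilon_{\alpha\beta}=\{(x,\alpha x+\beta+t\epsilon):x,t\in\mathbb{R}\}$. For $(x,y)\in\mathbb{R}\times\mathbb{R}^\epsilon$ let $\mathrm{proj}_\alpha(x,y)=y-\alpha x$. Define $\ell^\epsilon_{\alpha\beta}\vee H^\infty=\{a\in\mathbb{R}: a+b\epsilon\in \mathrm{proj}_\alpha(\ell^\epsilon_{\alpha\beta})\cap(\mathbb{R}^\epsilon\setminus\mathrm{proj}_\alpha(H^\infty))\text{ for some }b\in\mathbb{R}\}$. The infinite line $\ell^\epsilon_{\alpha\beta}$ is a line of sight for $H^\infty$ (and $H^\infty$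 admits it) if $\ell^\epsilon_{\alpha\beta}\vee H^\infty\ne\emptyset$. $H^\infty$ is periodic with period $m>0$ ($m$ an integer) if there is $k\in\mathbb{Z}$ such that $D_{i+m}=D_i+k=(d_i+k,d_i+k+1)$ for all $i$; it is periodic if it is periodic with some period $m$. *)

theory Defs
  imports Complex_Main "HOL-Library.Product_Plus" "HOL-Library.Product_Lexorder"
begin

text \<open>
  The pair \<open>(a, b)\<close> stands for \<open>a + b\<epsilon>\<close>. Addition and subtraction are componentwise
  (Product_Plus) and the order, hence every interval, is lexicographic (Product_Lexorder).
\<close>
type_synonym reps = "real \<times> real"

definition reps_of_real :: "real \<Rightarrow> reps" where
  "reps_of_real a = (a, 0)"

definition eps_line :: "real \<Rightarrow> real \<Rightarrow> (real \<times> reps) set" where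
  "eps_line \<alpha> \<beta> = {(x, (\<alpha> * x + \<beta>, t)) | x t. True}"

definition proj :: "real \<Rightarrow> real \<times> reps \<Rightarrow> reps" where
  "proj \<alpha> = (\<lambda>(x, y). y - reps_of_real (\<alpha> * x))"

text \<open>
  A hallway is given by its sequence \<open>d\<close> of doorway positions. It determines \<open>d\<close>, so
  periodicity may be expressed through \<open>d\<close>, while lines of sight only use the set.
\<close>
definition doorway :: "(nat \<Rightarrow> int) \<Rightarrow> nat \<Rightarrow> reps set" where
  "doorway d i = {reps_of_real (of_int (d i)) <..< reps_of_real (of_int (d i) + 1)}"

definition hallway :: "(nat \<Rightarrow> int) \<Rightarrow> (real \<times> reps) set" where
  "hallway d = (\<Union>i. {real i} \<times> (UNIV - doorway d i))"

text \<open>The set \<open>\<ell> \<or> H\<close> for the line of slope \<open>\<alpha>\<close> and intercept \<open>\<beta>\<close>.\<close>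
definition sight_set :: "real \<Rightarrow> real \<Rightarrow> (real \<times> reps) set \<Rightarrow> real set" where
  "sight_set \<alpha> \<beta> H =
     {a. \<exists>b. (a, b) \<in> proj \<alpha> ` eps_line \<alpha> \<beta> \<inter> (UNIV - proj \<alpha> ` H)}"

definition line_of_sight :: "real \<Rightarrow> real \<Rightarrow> (real \<times> reps) set \<Rightarrow> bool" where
  "line_of_sight \<alpha> \<beta> H \<longleftrightarrow> sight_set \<alpha> \<beta> H \<noteq> {}"

definition periodic_with :: "(nat \<Rightarrow> int) \<Rightarrow> nat \<Rightarrow> bool" where
  "periodic_with d m \<longleftrightarrow> m > 0 \<and>
     (\<exists>k::int. \<forall>i. doorway d (i + m) = (\<lambda>y. y + reps_of_real (of_int k)) ` doorway d i)"

definition periodic_hallway :: "(nat \<Rightarrow> int) \<Rightarrow> bool" where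
  "periodic_hallway d \<longleftrightarrow> (\<exists>m. periodic_with d m)"

end

theory Submission imports Defs
begin

text \<open>
  A line of slope \<open>\<alpha>\<close> and intercept \<open>\<beta>\<close> is a line of sight exactly when one infinitesimal shift
  \<open>b\<close> puts every point \<open>\<alpha>i + \<beta> + b\<epsilon>\<close> inside the \<open>i\<close>th doorway (\<open>line_of_sight_iff\<close>). The
  doorways are open unit intervals with integer endpoints, so the possible doorways are pairwise
  disjoint and permuted by integer translations; a point determines the doorway that contains it.

  If \<open>\<alpha> = p/q\<close>, then passing from \<open>i\<close> to \<open>i + q\<close> moves the point by the integer \<open>p\<close>, keeping \<open>b\<close>.
  Hence the doorway moves by \<open>p\<close> as well, and the hallway has period \<open>q\<close>.

  Conversely, if the hallway repeats after \<open>m\<close> steps with translation \<open>k\<close>, then \<open>d (jm) = d 0 + jk\<close>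
  for all \<open>j\<close>. The points of any line of sight stay within distance 1 of the doorway positions, so
  \<open>j(\<alpha>m - k)\<close> is bounded in \<open>j\<close>. This forces \<open>\<alpha> = k/m\<close>: every line of sight of a periodic hallway
  is rational.
\<close>

text \<open>
  The infinitesimal part matters only at an endpoint of the doorway, where its sign decides
  whether the point lies inside.
\<close>
lemma mem_doorway_iff:
  "(x, b) \<in> doorway d i \<longleftrightarrow>
     of_int (d i) < x \<and> x < of_int (d i) + 1 \<or> x = of_int (d i) \<and> b > 0
     \<or> x = of_int (d i) + 1 \<and> b < 0"
  by (auto simp: doorway_def reps_of_real_def less_prod_def)

lemma doorway_nonempty: "doorway d i \<noteq> {}"
proof -
  have "(of_int (d i) + 1/2, 0) \<in> doorway d i"
    by (simp add: mem_doorway_iff)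
  then show ?thesis by blast
qed

text \<open>
  The real parts of points in two different doorways coincide at most at a common endpoint, and
  there one doorway asks for a positive and the other for a negative infinitesimal part.
\<close>
lemma doorway_position_unique:
  assumes "z \<in> doorway d i" "z \<in> doorway e j"
  shows "d i = e j"
proof -
  obtain x b where z: "z = (x, b)" by (cases z)
  have "d i < e j + 1"
    using assms unfolding z mem_doorway_iff by linarith
  moreover have "e j < d i + 1"
    using assms unfolding z mem_doorway_iff by linarith
  ultimately show ?thesis by linarith
qed

lemma doorway_translate:
  "(\<lambda>y. y + reps_of_real (of_int k)) ` doorway d i = doorway (\<lambda>n. d n + k) i"
proof (intro equalityI subsetI)
  fix z assume "z \<in> (\<lambda>y. y + reps_of_real (of_int k)) ` doorway d i"
  then show "z \<in> doorway (\<lambda>n. d n + k) i"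
    by (auto simp: mem_doorway_iff reps_of_real_def)
next
  fix z assume z: "z \<in> doorway (\<lambda>n. d n + k) i"
  obtain x b where xb: "z = (x, b)" by (cases z)
  have "(x - of_int k, b) \<in> doorway d i"
    using z by (auto simp: xb mem_doorway_iff)
  then show "z \<in> (\<lambda>y. y + reps_of_real (of_int k)) ` doorway d i"
    by (rule rev_image_eqI) (simp add: xb reps_of_real_def)
qed

text \<open>
  Periodicity of the doorways is periodicity of the increments of their positions, because a
  doorway, being nonempty, determines its position.
\<close>
lemma periodic_with_iff:
  "periodic_with d m \<longleftrightarrow> m > 0 \<and> (\<exists>k. \<forall>i. d (i + m) = d i + k)"
proof -
  have "doorway d (i + m) = doorway (\<lambda>n. d n + k) i \<longleftrightarrow> d (i + m) = d i + k" for i k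
  proof
    assume eq: "doorway d (i + m) = doorway (\<lambda>n. d n + k) i"
    obtain z where "z \<in> doorway d (i + m)" using doorway_nonempty by blast
    then show "d (i + m) = d i + k" using doorway_position_unique eq by blast
  next
    assume "d (i + m) = d i + k"
    then show "doorway d (i + m) = doorway (\<lambda>n. d n + k) i" by (simp add: doorway_def)
  qed
  then show ?thesis by (simp add: periodic_with_def doorway_translate)
qed

text \<open>
  Projecting along slope \<open>\<alpha>\<close> sends the line onto the fibre over \<open>\<beta>\<close>, so a point \<open>\<beta> + b\<epsilon>\<close>
  escapes the projection of the walls iff its translate along the line meets no wall.
\<close>
lemma line_of_sight_iff:
  "line_of_sight \<alpha> \<beta> (hallway d) \<longleftrightarrow> (\<exists>b. \<forall>i. (\<alpha> * real i + \<beta>, b) \<in> doorway d i)"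
proof -
  have line: "proj \<alpha> ` eps_line \<alpha> \<beta> = {(\<beta>, b) | b. True}"
    by (force simp: proj_def eps_line_def reps_of_real_def image_iff)
  have wall: "(\<beta>, b) \<notin> proj \<alpha> ` hallway d \<longleftrightarrow> (\<forall>i. (\<alpha> * real i + \<beta>, b) \<in> doorway d i)" for b
  proof -
    have "(\<beta>, b) = y - reps_of_real (\<alpha> * real i) \<longleftrightarrow> y = (\<alpha> * real i + \<beta>, b)" for y i
      by (cases y) (auto simp: reps_of_real_def)
    then show ?thesis by (auto simp: hallway_def proj_def image_iff)
  qed
  show ?thesis unfolding line_of_sight_def sight_set_def line using wall by auto
qed

lemma periodic_if_rational_line_of_sight:
  assumes "\<alpha> \<in> \<rat>" and "line_of_sight \<alpha> \<beta> (hallway d)"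
  shows "periodic_hallway d"
proof -
  obtain p q where \<alpha>: "\<alpha> = of_int p / real q" and q: "q \<noteq> 0"
    using assms(1) by (auto simp: Rats_eq_int_div_nat)
  obtain b where b: "\<And>i. (\<alpha> * real i + \<beta>, b) \<in> doorway d i"
    using assms(2) by (auto simp: line_of_sight_iff)
  have "d (i + q) = d i + p" for i
  proof (rule doorway_position_unique)
    show "(\<alpha> * real (i + q) + \<beta>, b) \<in> doorway d (i + q)" by (rule b)
    have "\<alpha> * real (i + q) + \<beta> = \<alpha> * real i + \<beta> + of_int p"
      using q by (simp add: \<alpha> field_simps)
    then show "(\<alpha> * real (i + q) + \<beta>, b) \<in> doorway (\<lambda>n. d n + p) i"
      using b[of i] by (auto simp: mem_doorway_iff)
  qed
  then show ?thesis using q by (auto simp: periodic_hallway_def periodic_with_iff)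
qed

text \<open>
  The slope of a line of sight is the asymptotic slope of the doorway positions, which
  periodicity makes equal to translation over period.
\<close>
lemma slope_of_line_of_sight_if_periodic:
  assumes m: "m > 0" and per: "\<And>i. d (i + m) = d i + k"
    and "line_of_sight \<alpha> \<beta> (hallway d)"
  shows "\<alpha> = of_int k / real m"
proof -
  obtain b where b: "\<And>i. (\<alpha> * real i + \<beta>, b) \<in> doorway d i"
    using assms(3) by (auto simp: line_of_sight_iff)
  have near: "\<bar>\<alpha> * real i + \<beta> - of_int (d i)\<bar> \<le> 1" for i
    using b[of i] unfolding mem_doorway_iff by linarith
  have d_mult: "d (j * m) = d 0 + int j * k" for j
  proof (induction j)
    case (Suc j)
    then show ?case using per[of "j * m"] by (simp add: algebra_simps)
  qed simp
  define c where "c = \<alpha> * real m - of_int k"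
  have bound: "real j * \<bar>c\<bar> \<le> 2" for j
  proof -
    have "real j * c = (\<alpha> * real (j * m) + \<beta> - of_int (d (j * m))) - (\<beta> - of_int (d 0))"
      by (simp add: c_def d_mult algebra_simps)
    then have "\<bar>real j * c\<bar> \<le> 2"
      using near[of "j * m"] near[of 0] by simp
    then show ?thesis by (simp add: abs_mult)
  qed
  have "c = 0"
  proof (rule ccontr)
    assume "c \<noteq> 0"
    then obtain j where "2 < real j * \<bar>c\<bar>"
      using reals_Archimedean3[of "\<bar>c\<bar>"] by auto
    then show False using bound[of j] by simp
  qed
  then show ?thesis using m by (simp add: c_def field_simps)
qed

theorem theorem29:
  fixes d :: "nat \<Rightarrow> int"
  assumes "\<exists>\<alpha> \<beta>. line_of_sight \<alpha> \<beta> (hallway d)"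
  shows "periodic_hallway d \<longleftrightarrow> (\<exists>\<alpha> \<beta>. \<alpha> \<in> \<rat> \<and> line_of_sight \<alpha> \<beta> (hallway d))"
proof
  assume "periodic_hallway d"
  then obtain m k where mk: "m > 0" "\<And>i. d (i + m) = d i + k"
    by (auto simp: periodic_hallway_def periodic_with_iff)
  obtain \<alpha> \<beta> where los: "line_of_sight \<alpha> \<beta> (hallway d)" using assms by blast
  have "\<alpha> = of_int k / real m" by (rule slope_of_line_of_sight_if_periodic[OF mk los])
  then have "\<alpha> \<in> \<rat>" by simp
  then show "\<exists>\<alpha> \<beta>. \<alpha> \<in> \<rat> \<and> line_of_sight \<alpha> \<beta> (hallway d)" using los by blast
next
  assume "\<exists>\<alpha> \<beta>. \<alpha> \<in> \<rat> \<and> line_of_sight \<alpha> \<beta> (hallway d)"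
  then show "periodic_hallway d" using periodic_if_rational_line_of_sight by blast
qed

end
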